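(* Suppose $\mathcal B$ is a quasi-Banach algebra and $\mathcal M$ is a left quasi-Banach $\mathcal B$ module. Also suppose that $\mathcal B$ possesses a bounded left approximate identity for $(\mathcal B,\mathcal M)$. Then $$\mathcal B\cdot\mathcal M=\mathcal M,$$ where $\mathcal B\cdot\mathcal M=\{\phi\cdot f:\phi\in\mathcal B,\ f\in\mathcal M\}$.
   Context: All vector spaces are over $\mathbf C$. Let $p\in(0,1]$. A $p$-norm (quasi-norm of order $p$) on a vector space $\mathcal B$ is a map $\|\cdot\|_{\mathcal B}:\mathcal B\to\mathbf R$ with $\|\phi+\psi\|_{\mathcal B}\le 2^{\frac1p-1}(\|\phi\|_{\mathcal B}+\|\psi\|_{\mathcal B})$, $\|\alpha\phi\|_{\mathcal B}=|\alpha|\|\phi\|_{\mathcal B}$, $\|\phi\|_{\mathcal B}>0$ for $\phi\ne0$, and, by convention, always chosen such that $\|\phi+\psi\|_{\mathcal B}^p\le\|\phi\|_{\mathcal B}^p+\|\psi\|_{\mathcal B}^p$. A quasi-Banach space of order $p$ is a vector space which is complete under a $p$-norm. A quasi-Banach algebra of order $p$ is an algebra $\mathcal B$ which is a quasi-Banach space of order $p$ such that $\|\phi\psi\|_{\mathcal B}\le C\|\phi\|_{\mathcal B}\|\psi\|_{\mathcal B}$ for some constant $C>0$. A left quasi-Banach $\mathcal B$ module of order $p$ is a left $\mathcal B$ module $\mathcal M$ which is a quasi-Banach space of order $p$ such that $\|\phi\cdot f\|_{\mathcal M}\le C\|\phi\|_{\mathcal B}\|f\|_{\mathcal M}$ for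 some constant $C>0$ and all $\phi\in\mathcal B$, $f\in\mathcal M$. Here $\mathcal B$ and $\mathcal M$ are of the same order $p$, for some $p\in(0,1]$. $\mathcal B$ possesses a bounded left approximate identity for $(\mathcal B,\mathcal M)$ (of order $r>0$) if there is $r>0$ such that for every $\varepsilon>0$, every finite set $\{\psi_1,\dots,\psi_n\}\subseteq\mathcal B$ and every $f\in\mathcal M$, there is $\phi_\varepsilon\in\mathcal B$ with $\|\phi_\varepsilon\|_{\mathcal B}\le r$, $\|\phi_\varepsilon\psi_j-\psi_j\|_{\mathcal B}<\varepsilon$ for $j=1,\dots,n$, and $\|\phi_\varepsilon\cdot f-f\|_{\mathcal M}<\varepsilon$. *)

theory Defs
  imports Complex_Main
begin

text \<open>
  The norm of a quasi-Banach space is an explicit function \<open>N\<close>, because the type-class norm of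
  the library satisfies the triangle inequality with constant 1. Complex scalar multiplication is
  likewise an explicit argument, as the scalars of the class \<^class>\<open>real_vector\<close> are real.
\<close>

locale p_normed_space = vector_space scale
  for p :: real
    and scale :: "complex \<Rightarrow> 'a::ab_group_add \<Rightarrow> 'a"
    and N :: "'a \<Rightarrow> real" +
  assumes p_pos: "0 < p"
    and p_le_1: "p \<le> 1"
    and quasi_triangle: "N (x + y) \<le> 2 powr (1 / p - 1) * (N x + N y)"
    and homogeneous: "N (scale a x) = cmod a * N x"
    and positive: "x \<noteq> 0 \<Longrightarrow> N x > 0"
    and p_triangle: "N (x + y) powr p \<le> N x powr p + N y powr p"

locale quasi_banach_space = p_normed_space p scale N
  for p :: real
    and scale :: "complex \<Rightarrow> 'a::ab_group_add \<Rightarrow> 'a"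
    and N :: "'a \<Rightarrow> real" +
  assumes complete:
    "(\<And>e. e > 0 \<Longrightarrow> \<exists>n0. \<forall>m\<ge>n0. \<forall>n\<ge>n0. N (X m - X n) < e)
      \<Longrightarrow> \<exists>x. (\<lambda>n::nat. N (X n - x)) \<longlonglongrightarrow> 0"

text \<open>
  The class \<^class>\<open>ring\<close> supplies an associative multiplication without requiring a unit.
\<close>

locale quasi_banach_algebra = quasi_banach_space p scale N
  for p :: real
    and scale :: "complex \<Rightarrow> 'b::ring \<Rightarrow> 'b"
    and N :: "'b \<Rightarrow> real" +
  assumes scale_mult_left: "scale a x * y = scale a (x * y)"
    and scale_mult_right: "x * scale a y = scale a (x * y)"
    and mult_bounded: "\<exists>C>0. \<forall>x y. N (x * y) \<le> C * N x * N y"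

locale left_quasi_banach_module =
  B: quasi_banach_algebra p scaleB normB + M: quasi_banach_space p scaleM normM
  for p :: real
    and scaleB :: "complex \<Rightarrow> 'b::ring \<Rightarrow> 'b"
    and normB :: "'b \<Rightarrow> real"
    and scaleM :: "complex \<Rightarrow> 'm::ab_group_add \<Rightarrow> 'm"
    and normM :: "'m \<Rightarrow> real"
    and act :: "'b \<Rightarrow> 'm \<Rightarrow> 'm" +
  assumes act_add_left: "act (\<phi> + \<psi>) f = act \<phi> f + act \<psi> f"
    and act_add_right: "act \<phi> (f + g) = act \<phi> f + act \<phi> g"
    and act_scale_left: "act (scaleB a \<phi>) f = scaleM a (act \<phi> f)"
    and act_scale_right: "act \<phi> (scaleM a f) = scaleM a (act \<phi> f)"
    and act_mult: "act (\<phi> * \<psi>) f = act \<phi> (act \<psi> f)"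
    and act_bounded: "\<exists>C>0. \<forall>\<phi> f. normM (act \<phi> f) \<le> C * normB \<phi> * normM f"

definition has_bounded_left_approx_identity ::
    "('b::ring \<Rightarrow> real) \<Rightarrow> ('m::ab_group_add \<Rightarrow> real) \<Rightarrow> ('b \<Rightarrow> 'm \<Rightarrow> 'm) \<Rightarrow> bool" where
  "has_bounded_left_approx_identity normB normM act \<longleftrightarrow>
    (\<exists>r>0. \<forall>\<epsilon>>0. \<forall>\<Psi> f. finite \<Psi> \<longrightarrow>
      (\<exists>\<phi>. normB \<phi> \<le> r \<and> (\<forall>\<psi>\<in>\<Psi>. normB (\<phi> * \<psi> - \<psi>) < \<epsilon>) \<and> normM (act \<phi> f - f) < \<epsilon>))"

end

theory Submission imports Defs begin

text \<open>
  Cohen's factorization argument, with products in place of sums. For an approximate unit \<open>e\<close> and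
  small \<open>\<lambda>\<close>, the operator \<open>E = (1 - \<lambda>) + \<lambda> e\<close> on the module is onto and bounded below, by a Neumann
  series. Choosing \<open>e\<^sub>1, e\<^sub>2, \<dots>\<close> successively, the products \<open>P\<^sub>n = E\<^sub>n \<cdots> E\<^sub>1\<close> have the form
  \<open>(1 - \<lambda>)\<^sup>n + a\<^sub>n\<close> with \<open>a\<^sub>n\<close> in the algebra. As \<open>e\<^sub>n\<^sub>+\<^sub>1 a\<^sub>n\<close> is close to \<open>a\<^sub>n\<close>, the \<open>a\<^sub>n\<close> converge to
  some \<open>a\<close>; as \<open>e\<^sub>n\<^sub>+\<^sub>1 f\<close> is close to \<open>f\<close> (to a precision depending on the lower bound of \<open>P\<^sub>n\<close>), the
  preimages \<open>g\<^sub>n = P\<^sub>n\<^sup>-\<^sup>1 f\<close> converge to some \<open>g\<close>. In the limit, \<open>f = a g\<close>.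
\<close>

section \<open>Elementary facts on p-norms and convergence of geometrically controlled
  sequences\<close>

context p_normed_space
begin

lemma N_zero: "N 0 = 0"
  using homogeneous[of 0 0] by simp

lemma N_nonneg: "N x \<ge> 0"
  using positive[of x] N_zero by (cases "x = 0") auto

lemma N_eq_zero_iff: "N x = 0 \<longleftrightarrow> x = 0"
  using positive[of x] N_zero by (cases "x = 0") auto

lemma N_minus: "N (- x) = N x"
  using homogeneous[of "-1" x] by simp

lemma N_diff_commute: "N (x - y) = N (y - x)"
  using N_minus[of "x - y"] by simp

lemma N_scale_of_real: "t \<ge> 0 \<Longrightarrow> N (scale (complex_of_real t) x) = t * N x"
  by (simp add: homogeneous)

lemma quasi_triangle_diff: "N (x - y) \<le> 2 powr (1 / p - 1) * (N x + N y)"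
  using quasi_triangle[of x "- y"] by (simp add: N_minus)

lemma tendsto_N_add:
  assumes "(\<lambda>n. N (X n)) \<longlonglongrightarrow> 0" and "(\<lambda>n. N (Y n)) \<longlonglongrightarrow> 0"
  shows "(\<lambda>n. N (X n + Y n)) \<longlonglongrightarrow> 0"
proof (rule tendsto_sandwich[OF _ _ tendsto_const])
  show "(\<lambda>n. 2 powr (1 / p - 1) * (N (X n) + N (Y n))) \<longlonglongrightarrow> 0"
    using tendsto_mult_left[OF tendsto_add[OF assms]] by simp
qed (auto intro!: always_eventually N_nonneg quasi_triangle)

text \<open>Estimates p-th powers because these are subadditive with constant 1; iterating
  \<open>quasi_triangle\<close> would accumulate its constant.\<close>

lemma N_powr_telescope:
  "N (X (n + j) - X n) powr p \<le> (\<Sum>i = n..<n + j. N (X (Suc i) - X i) powr p)"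
proof (induction j)
  case 0
  then show ?case by (simp add: N_zero)
next
  case (Suc j)
  have "N (X (n + Suc j) - X n) powr p
      = N ((X (Suc (n + j)) - X (n + j)) + (X (n + j) - X n)) powr p"
    by simp
  also have "\<dots> \<le> N (X (Suc (n + j)) - X (n + j)) powr p + N (X (n + j) - X n) powr p"
    by (rule p_triangle)
  finally show ?case
    using Suc.IH by simp
qed

end

text \<open>The p-th powers of the steps are dominated by a geometric series of ratio
  \<open>q powr p\<close> < 1, so telescoping makes the sequence Cauchy.\<close>

lemma (in quasi_banach_space) convergent_if_geometric:
  assumes step: "\<And>n. N (X (Suc n) - X n) \<le> K * q ^ n" and q: "0 < q" "q < 1"
  shows "\<exists>x. (\<lambda>n. N (X n - x)) \<longlonglongrightarrow> 0"
proof (rule complete)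
  fix e :: real
  assume e: "e > 0"
  define s where "s i = N (X (Suc i) - X i) powr p" for i
  have K: "K \<ge> 0"
    using step[of 0] N_nonneg[of "X (Suc 0) - X 0"] by simp
  have s_le: "s i \<le> K powr p * (q powr p) ^ i" for i
  proof -
    have "s i \<le> (K * q ^ i) powr p"
      unfolding s_def using step p_pos by (intro powr_mono2) (auto intro: N_nonneg)
    also have "\<dots> = K powr p * (q ^ i) powr p"
      using K q by (simp add: powr_mult)
    also have "(q ^ i) powr p = (q powr p) ^ i"
      using q by (simp add: powr_realpow[symmetric] powr_powr mult.commute)
    finally show ?thesis .
  qed
  have "summable (\<lambda>i. K powr p * (q powr p) ^ i)"
    using q p_pos powr_less_mono2[of p q 1]
    by (intro summable_mult summable_geometric) auto
  then have summable: "summable s"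
    by (rule summable_comparison_test'[where N = 0]) (use s_le in \<open>simp add: s_def\<close>)
  have "e powr p > 0"
    using e by simp
  then obtain n0 where n0: "\<And>m n. m \<ge> n0 \<Longrightarrow> norm (sum s {m..<n}) < e powr p"
    using summable unfolding summable_Cauchy by blast
  have le: "N (X m - X n) < e" if "n0 \<le> n" "n \<le> m" for m n
  proof -
    have "N (X m - X n) powr p \<le> sum s {n..<m}"
      using N_powr_telescope[of X n "m - n"] that by (simp add: s_def)
    also have "\<dots> < e powr p"
      using n0[of n m] that by simp
    finally show ?thesis
      using e p_pos N_nonneg powr_mono2[of p e "N (X m - X n)"] by force
  qed
  then show "\<exists>n0. \<forall>m\<ge>n0. \<forall>n\<ge>n0. N (X m - X n) < e"
    by (metis N_diff_commute nat_le_linear)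
qed

section \<open>Operators of the form scalar plus algebra element on the module\<close>

context left_quasi_banach_module
begin

abbreviation scale_real :: "real \<Rightarrow> 'm \<Rightarrow> 'm" where
  "scale_real t \<equiv> scaleM (complex_of_real t)"

lemma act_diff_left: "act (\<phi> - \<psi>) f = act \<phi> f - act \<psi> f"
  using act_add_left[of "\<phi> - \<psi>" \<psi> f] by simp

lemma act_diff_right: "act \<phi> (f - g) = act \<phi> f - act \<phi> g"
  using act_add_right[of \<phi> "f - g" g] by simp

text \<open>This is the action of \<open>t + a\<close> in the unitization of the algebra; keeping
  the two parts separate avoids constructing a unit.\<close>

definition shift :: "real \<Rightarrow> 'b \<Rightarrow> 'm \<Rightarrow> 'm" where
  "shift t a x = scale_real t x + act a x"

lemma shift_diff: "shift t a (x - y) = shift t a x - shift t a y"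
  by (simp add: shift_def act_diff_right M.scale_right_diff_distrib)

text \<open>The product \<open>(s + e) (t + a)\<close> in the unitization: the scalars multiply and
  everything else stays in the algebra.\<close>

lemma shift_shift:
  "shift s e (shift t a x)
    = shift (s * t) (scaleB (complex_of_real s) a + e * a + scaleB (complex_of_real t) e) x"
  by (simp add: shift_def act_add_left act_add_right act_scale_left act_scale_right act_mult
      M.scale_right_distrib algebra_simps)

text \<open>A solution of \<open>t y + e y = x\<close> is a fixed point of \<open>T\<close>, which
  contracts by 1/2 thanks to \<open>small\<close>. The iterates from 0 are the partial sums of the
  Neumann series.\<close>

lemma surj_shift:
  assumes t: "t > 0" and small: "\<And>x. 2 * normM (act e x) \<le> t * normM x"
  shows "surj (shift t e)"
proof -
  have "\<exists>y. shift t e y = x" for x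
  proof -
    define T where "T y = scale_real (1 / t) (x - act e y)" for y
    define Y where "Y n = (T ^^ n) 0" for n
    have Y_Suc: "Y (Suc n) = T (Y n)" for n
      by (simp add: Y_def)
    have contraction: "normM (T y - T z) \<le> 1 / 2 * normM (y - z)" for y z
    proof -
      have "T y - T z = scale_real (1 / t) (act e (z - y))"
        by (simp add: T_def act_diff_right M.scale_right_diff_distrib)
      then have "normM (T y - T z) = 1 / t * normM (act e (z - y))"
        using t by (simp only: M.N_scale_of_real zero_le_divide_1_iff less_imp_le)
      also have "\<dots> \<le> 1 / t * (t * normM (z - y) / 2)"
        using t small[of "z - y"] by (intro mult_left_mono) auto
      finally show ?thesis
        using t by (simp add: M.N_diff_commute)
    qed
    have "normM (Y (Suc n) - Y n) \<le> normM (Y 1 - Y 0) * (1 / 2) ^ n" for n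
    proof (induction n)
      case (Suc n)
      then show ?case
        using contraction[of "Y (Suc n)" "Y n"] by (simp add: Y_Suc)
    qed simp
    then obtain y where y: "(\<lambda>n. normM (Y n - y)) \<longlonglongrightarrow> 0"
      using M.convergent_if_geometric[of Y "normM (Y 1 - Y 0)" "1 / 2"] by auto
    \<comment> \<open>The constant vector \<open>T y - y\<close> will be split at
      \<open>T (Y n) = Y (Suc n)\<close> into two terms that tend to 0.\<close>
    have "(\<lambda>n. normM (T y - T (Y n))) \<longlonglongrightarrow> 0"
    proof (rule tendsto_sandwich[OF _ _ tendsto_const])
      show "(\<lambda>n. 1 / 2 * normM (Y n - y)) \<longlonglongrightarrow> 0"
        using tendsto_mult_left[OF y, of "1 / 2"] by simp
      show "\<forall>\<^sub>F n in sequentially. normM (T y - T (Y n)) \<le> 1 / 2 * normM (Y n - y)"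
        using contraction by (simp add: M.N_diff_commute[of _ y])
    qed (simp add: M.N_nonneg)
    then have "(\<lambda>n. normM ((T y - T (Y n)) + (Y (Suc n) - y))) \<longlonglongrightarrow> 0"
      by (rule M.tendsto_N_add) (rule LIMSEQ_Suc[OF y])
    then have "normM (T y - y) = 0"
      by (simp add: Y_Suc LIMSEQ_const_iff)
    then have "T y = y"
      by (simp add: M.N_eq_zero_iff)
    then have "scale_real t y = scale_real t (T y)"
      by simp
    also have "\<dots> = x - act e y"
      using t by (simp add: T_def flip: of_real_mult)
    finally show ?thesis
      by (intro exI[of _ y]) (simp add: shift_def)
  qed
  then show ?thesis
    by (metis surjI)
qed

text \<open>Write \<open>t x = (t + e) x - e x\<close>; the factor in \<open>small\<close> lets the
  last term be absorbed in half of the left side.\<close>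

lemma shift_bounded_below:
  assumes t: "t > 0"
    and small: "\<And>x. 2 * 2 powr (1 / p - 1) * normM (act e x) \<le> t * normM x"
  shows "normM x \<le> 2 * 2 powr (1 / p - 1) / t * normM (shift t e x)"
proof -
  have "t * normM x = normM (shift t e x - act e x)"
    using t by (simp add: shift_def M.N_scale_of_real)
  also have "\<dots> \<le> 2 powr (1 / p - 1) * (normM (shift t e x) + normM (act e x))"
    by (rule M.quasi_triangle_diff)
  finally have "t * normM x \<le> 2 * 2 powr (1 / p - 1) * normM (shift t e x)"
    using small[of x] by (simp add: algebra_simps)
  then show ?thesis
    using t by (simp add: field_simps)
qed

text \<open>The invariant of the construction: \<open>t + a\<close> is invertible with bounded
  inverse, and \<open>g\<close> is the preimage of \<open>f\<close>. No uniform \<open>L\<close> is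
  demanded, since each precision is chosen after \<open>L\<close> is known.\<close>

definition shift_preimage :: "real \<Rightarrow> 'm \<Rightarrow> 'b \<Rightarrow> 'm \<Rightarrow> bool" where
  "shift_preimage t f a g \<longleftrightarrow>
    surj (shift t a) \<and> (\<exists>L>0. \<forall>x. normM x \<le> L * normM (shift t a x)) \<and> shift t a g = f"

text \<open>Multiplies \<open>t + a\<close> from the left by \<open>q + (1 - q) e\<close>. This
  factor nearly fixes \<open>f\<close>, so the preimage hardly moves; \<open>e * a\<close> is close
  to \<open>a\<close>, so the algebra part changes by little more than a multiple of
  \<open>t e\<close>.\<close>

lemma shift_preimage_step:
  fixes q t r \<delta> :: real
  assumes approx: "\<And>\<epsilon> \<psi> f. \<epsilon> > 0 \<Longrightarrow>
      \<exists>e. normB e \<le> r \<and> normB (e * \<psi> - \<psi>) < \<epsilon> \<and> normM (act e f - f) < \<epsilon>"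
    and small: "\<And>e x. normB e \<le> r \<Longrightarrow>
      2 * 2 powr (1 / p - 1) * ((1 - q) * normM (act e x)) \<le> q * normM x"
    and q: "0 < q" "q < 1" and t: "t > 0" and \<delta>: "\<delta> > 0"
    and ag: "shift_preimage t f a g"
  shows "\<exists>a' g'. shift_preimage (q * t) f a' g' \<and> normM (g' - g) \<le> \<delta>
    \<and> normB (a' - a) \<le> 2 powr (1 / p - 1) * (\<delta> + t * r)"
proof -
  define k :: real where "k = 2 powr (1 / p - 1)"
  have k: "k \<ge> 1"
    using M.p_pos M.p_le_1 by (simp add: k_def ge_one_powr_ge_zero)
  define D where "D = 2 * k / q"
  have D: "D > 0"
    using k q by (simp add: D_def)
  obtain L where L: "L > 0" "\<And>x. normM x \<le> L * normM (shift t a x)"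
    and surj_a: "surj (shift t a)" and g: "shift t a g = f"
    using ag unfolding shift_preimage_def by blast
  \<comment> \<open>The bound \<open>\<delta>\<close> serves the algebra part. The other one serves
    the preimage, whose error is magnified by \<open>D\<close> for the new factor and by
    \<open>L\<close> for the old product.\<close>
  define \<epsilon> where "\<epsilon> = min \<delta> (\<delta> / (L * D))"
  have "\<epsilon> > 0"
    using \<delta> L(1) D by (simp add: \<epsilon>_def)
  then obtain e where e: "normB e \<le> r" "normB (e * a - a) < \<epsilon>" "normM (act e f - f) < \<epsilon>"
    using approx by blast
  define e' where "e' = scaleB (complex_of_real (1 - q)) e"
  have norm_e': "normM (act e' x) = (1 - q) * normM (act e x)" for x
    unfolding e'_def act_scale_left using q by (intro M.N_scale_of_real) simp
  have small': "2 * k * normM (act e' x) \<le> q * normM x" for x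
    using small[OF e(1), of x] by (simp add: norm_e' k_def)
  have "2 * normM (act e' x) \<le> q * normM x" for x
    using small'[of x] mult_right_mono[OF k M.N_nonneg[of "act e' x"]] by simp
  then have surj_e': "surj (shift q e')"
    using q by (intro surj_shift) auto
  have below_e': "normM x \<le> D * normM (shift q e' x)" for x
    using shift_bounded_below[of q e' x] small' q by (simp add: D_def k_def)

  define a' where
    "a' = scaleB (complex_of_real q) a + e' * a + scaleB (complex_of_real t) e'"
  have shift_a': "shift (q * t) a' x = shift q e' (shift t a x)" for x
    by (simp add: shift_shift a'_def)
  obtain y where y: "shift q e' y = f"
    using surj_e' by (metis surjD)
  obtain g' where g': "shift t a g' = y"
    using surj_a by (metis surjD)

  have "shift (q * t) a' = shift q e' \<circ> shift t a"
    by (simp add: fun_eq_iff shift_a')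
  then have "surj (shift (q * t) a')"
    using comp_surj[OF surj_a surj_e'] by simp
  moreover have "normM x \<le> L * D * normM (shift (q * t) a' x)" for x
  proof -
    have "normM x \<le> L * normM (shift t a x)"
      by (rule L(2))
    also have "\<dots> \<le> L * (D * normM (shift q e' (shift t a x)))"
      using L(1) below_e' by (intro mult_left_mono) auto
    finally show ?thesis
      by (simp add: shift_a' mult.assoc)
  qed
  then have "\<exists>L'>0. \<forall>x. normM x \<le> L' * normM (shift (q * t) a' x)"
    using L(1) D by (intro exI[of _ "L * D"]) simp
  ultimately have preimage: "shift_preimage (q * t) f a' g'"
    by (simp add: shift_preimage_def shift_a' g' y)

  \<comment> \<open>The new factor sends \<open>y\<close> to \<open>f\<close> and, its coefficients
    summing to 1, sends \<open>f\<close> to \<open>f + (1 - q) (e f - f)\<close>.\<close>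
  have "shift q e' (y - f) = scale_real (1 - q) (f - act e f)"
    by (simp add: shift_diff y)
       (simp add: shift_def e'_def act_scale_left M.scale_right_diff_distrib
         act_diff_left B.scale_left_diff_distrib M.scale_left_diff_distrib)
  then have "normM (shift q e' (y - f)) = (1 - q) * normM (f - act e f)"
    using q by (simp only: M.N_scale_of_real)
  also have "\<dots> \<le> 1 * \<epsilon>"
    using q e(3) by (intro mult_mono) (auto simp: M.N_diff_commute M.N_nonneg)
  finally have "normM (y - f) \<le> D * \<epsilon>"
    using below_e'[of "y - f"] D by (smt (verit) mult_left_mono)
  then have "normM (g' - g) \<le> L * (D * \<epsilon>)"
    using L(2)[of "g' - g"] L(1) by (simp add: shift_diff g g') (smt (verit) mult_left_mono)
  also have "\<dots> = (L * D) * \<epsilon>"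
    by simp
  also have "\<dots> \<le> (L * D) * (\<delta> / (L * D))"
    using L(1) D by (intro mult_left_mono) (auto simp: \<epsilon>_def)
  also have "\<dots> = \<delta>"
    using L(1) D by simp
  finally have norm_g': "normM (g' - g) \<le> \<delta>" .

  \<comment> \<open>The first term is small by the choice of \<open>e\<close>; the second only by
    the size of \<open>t\<close>, which will decay geometrically.\<close>
  have "a' - a = scaleB (complex_of_real (1 - q)) (e * a - a)
      + scaleB (complex_of_real (t * (1 - q))) e"
    by (simp add: a'_def e'_def B.scale_mult_left B.scale_right_diff_distrib
        B.scale_left_diff_distrib algebra_simps)
  then have "normB (a' - a) \<le> k * (normB (scaleB (complex_of_real (1 - q)) (e * a - a))
      + normB (scaleB (complex_of_real (t * (1 - q))) e))"
    unfolding k_def using B.quasi_triangle by metis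
  also have "\<dots> = k * ((1 - q) * normB (e * a - a) + t * (1 - q) * normB e)"
    using q t by (subst (1 2) B.N_scale_of_real) auto
  also have "\<dots> \<le> k * (1 * \<delta> + t * 1 * r)"
    using q t k e by (intro mult_left_mono add_mono mult_mono) (auto simp: \<epsilon>_def B.N_nonneg)
  finally show ?thesis
    using preimage norm_g' by (auto simp: k_def)
qed

section \<open>Construction of the sequences and passage to the limit\<close>

lemma factorization:
  assumes "has_bounded_left_approx_identity normB normM act"
  shows "\<exists>\<phi> g. f = act \<phi> g"
proof -
  define k :: real where "k = 2 powr (1 / p - 1)"
  have k: "k > 0"
    by (simp add: k_def)
  obtain r where r: "r > 0"
    and id: "\<And>\<epsilon> \<Psi> f. \<epsilon> > 0 \<Longrightarrow> finite \<Psi> \<Longrightarrow>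
      \<exists>\<phi>. normB \<phi> \<le> r \<and> (\<forall>\<psi>\<in>\<Psi>. normB (\<phi> * \<psi> - \<psi>) < \<epsilon>) \<and> normM (act \<phi> f - f) < \<epsilon>"
    using assms unfolding has_bounded_left_approx_identity_def by blast
  have approx: "\<exists>e. normB e \<le> r \<and> normB (e * \<psi> - \<psi>) < \<epsilon> \<and> normM (act e f - f) < \<epsilon>"
    if "\<epsilon> > 0" for \<epsilon> \<psi> f
    using id[OF that, of "{\<psi>}" f] by auto
  obtain C where C: "C > 0" "\<And>\<phi> f. normM (act \<phi> f) \<le> C * normB \<phi> * normM f"
    using act_bounded by blast
  \<comment> \<open>\<open>q\<close> solves \<open>(1 - q) * u = q\<close>, which is exactly the
    smallness required for all \<open>e\<close> of norm at most \<open>r\<close>.\<close>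
  define u where "u = 2 * k * C * r"
  have u: "u > 0"
    using k C(1) r by (simp add: u_def)
  define q where "q = u / (1 + u)"
  have q: "0 < q" "q < 1" and q_eq: "(1 - q) * u = q"
    using u by (auto simp: q_def field_simps)
  have small: "2 * 2 powr (1 / p - 1) * ((1 - q) * normM (act e x)) \<le> q * normM x"
    if "normB e \<le> r" for e x
  proof -
    have "normM (act e x) \<le> C * r * normM x"
      using C(2)[of e x] mult_right_mono[OF mult_left_mono[OF that, of C] M.N_nonneg[of x]] C(1)
      by linarith
    then have "2 * k * (1 - q) * normM (act e x) \<le> 2 * k * (1 - q) * (C * r * normM x)"
      using k q by (intro mult_left_mono) auto
    also have "\<dots> = (1 - q) * u * normM x"
      by (simp add: u_def)
    finally show ?thesis
      by (simp add: k_def q_eq mult.assoc)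
  qed

  \<comment> \<open>States pair an algebra part with a preimage, starting at \<open>(0, f)\<close>
    for the empty product. Stage \<open>n\<close> has scalar part \<open>q ^ n\<close> and also
    takes \<open>q ^ n\<close> as tolerance, so both increments are geometric.\<close>
  define P where "P n s \<longleftrightarrow> shift_preimage (q ^ n) f (fst s) (snd s)" for n :: nat and s
  define Q where "Q n s s' \<longleftrightarrow> normM (snd s' - snd s) \<le> q ^ n
    \<and> normB (fst s' - fst s) \<le> k * (1 + r) * q ^ n" for n :: nat and s s' :: "'b \<times> 'm"
  have act_0: "act 0 x = 0" for x
    using act_add_left[of 0 0 x] by simp
  have "shift 1 0 = id"
    by (auto simp: shift_def act_0)
  then have "P 0 (0, f)"
    by (auto simp: P_def shift_preimage_def intro!: exI[of _ 1])
  moreover have "\<exists>s'. P (Suc n) s' \<and> Q n s s'" if "P n s" for n s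
    using shift_preimage_step[OF approx small q, of "q ^ n" "q ^ n" f "fst s" "snd s"] that q
    by (force simp: P_def Q_def k_def algebra_simps)
  ultimately obtain S where P_S: "\<And>n. P n (S n)" and Q_S: "\<And>n. Q n (S n) (S (Suc n))"
    using dependent_nat_choice[of P Q] by blast
  define a where "a n = fst (S n)" for n
  define g where "g n = snd (S n)" for n
  have "normB (a (Suc n) - a n) \<le> k * (1 + r) * q ^ n"
    and "normM (g (Suc n) - g n) \<le> 1 * q ^ n" for n
    using Q_S[of n] by (auto simp: Q_def a_def g_def)
  then obtain \<phi> h where \<phi>: "(\<lambda>n. normB (a n - \<phi>)) \<longlonglongrightarrow> 0" and h: "(\<lambda>n. normM (g n - h)) \<longlonglongrightarrow> 0"
    using B.convergent_if_geometric[of a, OF _ q] M.convergent_if_geometric[of g, OF _ q] by metis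

  have bound: "normM (g n) \<le> k * (normM (g n - h) + normM h)" for n
    using M.quasi_triangle[of "g n - h" h] by (simp add: k_def)
  \<comment> \<open>By \<open>bound\<close>, the norms of the convergent \<open>g n\<close> stay
    bounded.\<close>
  have vanish: "(\<lambda>n. c n * normM (g n)) \<longlonglongrightarrow> 0"
    if c: "c \<longlonglongrightarrow> 0" and "\<And>n. c n \<ge> 0" for c :: "nat \<Rightarrow> real"
  proof (rule tendsto_sandwich[OF _ _ tendsto_const])
    show "(\<lambda>n. c n * (k * (normM (g n - h) + normM h))) \<longlonglongrightarrow> 0"
      using tendsto_mult[OF c tendsto_mult_left[OF tendsto_add[OF h tendsto_const]]] by simp
  qed (use that bound in \<open>auto intro!: always_eventually mult_left_mono mult_nonneg_nonneg M.N_nonneg\<close>)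
  have "(\<lambda>n. q ^ n) \<longlonglongrightarrow> 0"
    using q by (intro LIMSEQ_realpow_zero) auto
  then have "(\<lambda>n. normM (scale_real (q ^ n) (g n))) \<longlonglongrightarrow> 0"
    using vanish[of "\<lambda>n. q ^ n"] q by (subst M.N_scale_of_real) auto
  moreover have "(\<lambda>n. normM (act (a n - \<phi>) (g n))) \<longlonglongrightarrow> 0"
  proof (rule tendsto_sandwich[OF _ _ tendsto_const])
    show "(\<lambda>n. C * normB (a n - \<phi>) * normM (g n)) \<longlonglongrightarrow> 0"
      using vanish[of "\<lambda>n. C * normB (a n - \<phi>)"] tendsto_mult_left[OF \<phi>, of C] C(1)
      by (simp add: B.N_nonneg)
  qed (auto simp: M.N_nonneg C(2))
  moreover have "(\<lambda>n. normM (act \<phi> (g n - h))) \<longlonglongrightarrow> 0"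
  proof (rule tendsto_sandwich[OF _ _ tendsto_const])
    show "(\<lambda>n. C * normB \<phi> * normM (g n - h)) \<longlonglongrightarrow> 0"
      using tendsto_mult_left[OF h, of "C * normB \<phi>"] by simp
  qed (auto simp: M.N_nonneg C(2))
  ultimately have "(\<lambda>n. normM ((scale_real (q ^ n) (g n) + act (a n - \<phi>) (g n))
      + act \<phi> (g n - h))) \<longlonglongrightarrow> 0"
    by (intro M.tendsto_N_add)
  \<comment> \<open>The invariant says \<open>q ^ n g n + a n g n = f\<close>, so the three
    vanishing terms add up to a vector independent of \<open>n\<close>.\<close>
  moreover have "(scale_real (q ^ n) (g n) + act (a n - \<phi>) (g n)) + act \<phi> (g n - h)
      = f - act \<phi> h" for n
    using P_S[of n]
    by (simp add: P_def shift_preimage_def shift_def a_def g_def act_diff_left act_diff_right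
        algebra_simps)
  ultimately have "normM (f - act \<phi> h) = 0"
    by (simp add: LIMSEQ_const_iff)
  then show ?thesis
    by (auto simp: M.N_eq_zero_iff)
qed

end

theorem theorem1p4:
  fixes p :: real
    and scaleB :: "complex \<Rightarrow> 'b::ring \<Rightarrow> 'b"
    and normB :: "'b \<Rightarrow> real"
    and scaleM :: "complex \<Rightarrow> 'm::ab_group_add \<Rightarrow> 'm"
    and normM :: "'m \<Rightarrow> real"
    and act :: "'b \<Rightarrow> 'm \<Rightarrow> 'm"
  assumes "quasi_banach_algebra p scaleB normB"
    and "left_quasi_banach_module p scaleB normB scaleM normM act"
    and "has_bounded_left_approx_identity normB normM act"
  shows "{act \<phi> f | \<phi> f. True} = UNIV"
  using left_quasi_banach_module.factorization[OF assms(2,3)] by blast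

end
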